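(* There exists a constant $c>0$ such that for all sufficiently large $n$, $$r_n\geq n^{c\frac{\log n}{\log\log n}},$$ i.e. $r_n\geq n^{\Omega\left(\frac{\log n}{\log\log n}\right)}$.
   Context: Let $\Omega_n$ denote the set of all $n\times n$ real matrices all of whose entries are $\pm1$, and for an $n\times n$ matrix $A$ let $\mathrm{per}(A)=\sum_{\sigma\in S_n}\prod_{i=1}^n A_{i\sigma(i)}$ be its permanent. Let $r_n=|\{\mathrm{per}(A):A\in\Omega_n\}|$ be the number of distinct values attained by the permanent on $\Omega_n$. *)

theory Defs
  imports Complex_Main "HOL-Library.FuncSet" "HOL-Combinatorics.Permutations"
    "Jordan_Normal_Form.Matrix"
begin

(* Same conventions as Determinant.det: indices start at 0, and 0 off square matrices. *)
definition permanent :: "'a mat \<Rightarrow> 'a :: comm_ring_1" where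
  "permanent A = (if dim_row A = dim_col A then
     (\<Sum>p \<in> {p. p permutes {0..<dim_row A}}. \<Prod>i = 0..<dim_row A. A $$ (i, p i)) else 0)"

definition sign_mats :: "nat \<Rightarrow> real mat set" where
  "sign_mats n = {A \<in> carrier_mat n n. \<forall>i<n. \<forall>j<n. A $$ (i, j) = 1 \<or> A $$ (i, j) = - 1}"

definition num_permanents :: "nat \<Rightarrow> nat" where
  "num_permanents n = card (permanent ` sign_mats n)"

(* Hence the cardinality in num_permanents is a genuine count. *)
lemma finite_sign_mats: "finite (sign_mats n)"
proof (rule finite_subset)
  let ?F = "({0..<n} \<times> {0..<n}) \<rightarrow>\<^sub>E {1, - 1 :: real}"
  show "finite (mat n n ` ?F)"
    by (intro finite_imageI finite_PiE) auto
  show "sign_mats n \<subseteq> mat n n ` ?F"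
  proof
    fix A assume A: "A \<in> sign_mats n"
    let ?f = "restrict (\<lambda>ij. A $$ ij) ({0..<n} \<times> {0..<n})"
    have "A = mat n n ?f"
      using A by (intro eq_matI) (auto simp: sign_mats_def)
    moreover have "A $$ (i, j) \<in> {1, - 1}" if "i < n" "j < n" for i j
      using A that unfolding sign_mats_def by blast
    then have "?f \<in> ?F" by (intro restrict_PiE_iff[THEN iffD2]) auto
    ultimately show "A \<in> mat n n ` ?F" by (rule image_eqI)
  qed
qed

end

theory Submission
  imports Defs "HOL-Computational_Algebra.Polynomial" "HOL-Real_Asymp.Real_Asymp"
begin

text \<open>
  If the \<open>-1\<close> entries form a board \<open>B\<close> with rook numbers \<open>r\<^sub>j\<close>, the permanent is
  \<open>\<Sum>\<^sub>j (-2)^j r\<^sub>j (n-j)!\<close>, a linear functional of the rook polynomial. On a staircase of cells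
  a run of \<open>m\<close> consecutive cells has as rook polynomial the Fibonacci polynomial \<open>q\<^sub>m\<close>, runs
  separated by gaps multiply, and Cassini's identity says that replacing two runs of length
  \<open>m+1\<close> by runs of lengths \<open>m\<close> and \<open>m+2\<close> changes their product by exactly \<open>\<plusminus>x^(m+2)\<close>.
  Take \<open>T\<close> pairs of runs at each level \<open>m < K\<close>, of which \<open>t\<^sub>m\<close> are of the first kind. As long as
  the total number \<open>O(T K\<^sup>2)\<close> of cells is at most a small multiple of \<open>n\<close>, the first level at
  which two choices of the digits \<open>t\<^sub>m \<le> T\<close> differ dominates the difference of the permanents.
  This gives \<open>(T+1)^K\<close> values; \<open>T \<approx> \<surd>n\<close> and \<open>K \<approx> ln n\<close> suffice and even yield
  \<open>n powr (ln n / 4)\<close> values.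
\<close>

section \<open>Rook expansion of the permanent\<close>

text \<open>\<open>S\<close> is the graph of a partial injection of \<open>V\<close>. It uses as
  many rows as columns, so equally many of each remain, and any bijection \<open>h\<close> between
  the remaining ones completes it.\<close>

lemma permutes_extending_partial_injection:
  assumes V: "finite V" and S: "S \<subseteq> V \<times> V" "inj_on fst S" "inj_on snd S"
  obtains q where "q permutes V" "\<And>c. c \<in> S \<Longrightarrow> q (fst c) = snd c"
proof -
  have fin: "finite S" using V S(1) by (meson finite_SigmaI finite_subset)
  have sub: "fst ` S \<subseteq> V" "snd ` S \<subseteq> V" using S(1) by auto
  have "card (V - fst ` S) = card (V - snd ` S)"
    using V S fin sub by (simp add: card_Diff_subset card_image)
  then obtain h where h: "bij_betw h (V - fst ` S) (V - snd ` S)"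
    using V finite_same_card_bij by (metis finite_Diff)
  define g where "g = snd \<circ> inv_into S fst"
  have g: "bij_betw g (fst ` S) (snd ` S)"
    unfolding g_def using S
    by (intro bij_betw_trans[OF bij_betw_inv_into]) (auto simp: bij_betw_def)
  define q where "q x = (if x \<in> fst ` S then g x else if x \<in> V then h x else x)" for x
  have "bij_betw q (fst ` S) (snd ` S)"
    using g by (rule bij_betw_cong[THEN iffD1, rotated]) (simp add: q_def)
  moreover have "bij_betw q (V - fst ` S) (V - snd ` S)"
    using h by (rule bij_betw_cong[THEN iffD1, rotated]) (simp add: q_def)
  ultimately have "bij_betw q (fst ` S \<union> (V - fst ` S)) (snd ` S \<union> (V - snd ` S))"
    by (rule bij_betw_combine) auto
  moreover have "fst ` S \<union> (V - fst ` S) = V" "snd ` S \<union> (V - snd ` S) = V"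
    using sub by auto
  ultimately have "bij_betw q V V" by simp
  then have "q permutes V" by (rule bij_imp_permutes) (use sub in \<open>auto simp: q_def\<close>)
  moreover have "q (fst c) = snd c" if "c \<in> S" for c
    using that S(2) by (simp add: q_def g_def)
  ultimately show thesis by (rule that)
qed

text \<open>Composing with the inverse of one fixed extension \<open>q\<close> turns every extension
  into a permutation that fixes the rows of \<open>S\<close>, that is, into a permutation of the
  remaining \<open>card V - card S\<close> rows.\<close>

lemma card_permutes_extending:
  assumes V: "finite V" and S: "S \<subseteq> V \<times> V" "inj_on fst S" "inj_on snd S"
  shows "card {p. p permutes V \<and> (\<forall>c\<in>S. p (fst c) = snd c)} = fact (card V - card S)"
proof -
  obtain q where q: "q permutes V" "\<And>c. c \<in> S \<Longrightarrow> q (fst c) = snd c"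
    using permutes_extending_partial_injection[OF assms] by blast
  let ?W = "V - fst ` S"
  have fin: "finite S" using V S(1) by (meson finite_SigmaI finite_subset)
  have sub: "fst ` S \<subseteq> V" using S(1) by auto
  have "bij_betw ((\<circ>) q) {r. r permutes ?W}
          {p. p permutes V \<and> (\<forall>c\<in>S. p (fst c) = snd c)}"
  proof (rule bij_betw_byWitness[where f' = "(\<circ>) (inv_into UNIV q)"])
    show "\<forall>r\<in>{r. r permutes ?W}. inv_into UNIV q \<circ> (q \<circ> r) = r"
      using permutes_inv_o[OF q(1)] by (simp add: o_assoc)
    show "\<forall>p\<in>{p. p permutes V \<and> (\<forall>c\<in>S. p (fst c) = snd c)}. q \<circ> (inv_into UNIV q \<circ> p) = p"
      using permutes_inv_o[OF q(1)] by (simp add: o_assoc)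
    show "(\<circ>) q ` {r. r permutes ?W} \<subseteq> {p. p permutes V \<and> (\<forall>c\<in>S. p (fst c) = snd c)}"
    proof clarify
      fix r assume r: "r permutes ?W"
      have "q \<circ> r permutes V"
        using permutes_compose[OF permutes_subset[OF r] q(1)] by blast
      moreover have "(q \<circ> r) (fst c) = snd c" if "c \<in> S" for c
        using that permutes_not_in[OF r, of "fst c"] q(2) by auto
      ultimately show "q \<circ> r permutes V \<and> (\<forall>c\<in>S. (q \<circ> r) (fst c) = snd c)" by blast
    qed
    show "(\<circ>) (inv_into UNIV q) ` {p. p permutes V \<and> (\<forall>c\<in>S. p (fst c) = snd c)} \<subseteq> {r. r permutes ?W}"
    proof clarify
      fix p assume p: "p permutes V" "\<forall>c\<in>S. p (fst c) = snd c"
      have *: "inv_into UNIV q \<circ> p permutes V"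
        using permutes_compose[OF p(1) permutes_inv[OF q(1)]] .
      show "inv_into UNIV q \<circ> p permutes ?W"
      proof (rule permutes_superset[OF *])
        fix x assume "x \<in> V - ?W"
        then obtain c where c: "c \<in> S" "x = fst c" by auto
        then have "p x = q x" using p(2) q(2) by simp
        then show "(inv_into UNIV q \<circ> p) x = x" using permutes_inverses(2)[OF q(1)] by simp
      qed
    qed
  qed
  then have "card {p. p permutes V \<and> (\<forall>c\<in>S. p (fst c) = snd c)} = card {r. r permutes ?W}"
    by (rule bij_betw_same_card[symmetric])
  also have "\<dots> = fact (card V - card S)"
    using V fin sub S(2) by (intro card_permutations) (simp_all add: card_Diff_subset card_image)
  finally show ?thesis .
qed

definition rook_placements :: "('a \<times> 'b) set \<Rightarrow> ('a \<times> 'b) set set" where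
  "rook_placements B = {S. S \<subseteq> B \<and> inj_on fst S \<and> inj_on snd S}"

text \<open>For each permutation, expand the product of \<open>1 + w\<close> over the board cells on
  its graph into a sum over sets \<open>S\<close> of such cells, then exchange the sums. A set lying
  on the graph of a permutation has no two cells in a row or column; conversely a placement
  \<open>S\<close> lies on \<open>fact (n - card S)\<close> graphs.\<close>

lemma permanent_board:
  fixes w :: "'a :: {comm_ring_1, semiring_char_0}"
  assumes B: "B \<subseteq> {0..<n} \<times> {0..<n}"
  shows "permanent (mat n n (\<lambda>c. if c \<in> B then 1 + w else 1)) =
    (\<Sum>S\<in>rook_placements B. w ^ card S * fact (n - card S))"
proof -
  let ?P = "{p. p permutes {0..<n}}"
  have finB: "finite B" using B by (meson finite_SigmaI finite_atLeastLessThan finite_subset)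
  have finP: "finite ?P" by (simp add: finite_permutations)
  have row: "(\<Prod>i = 0..<n. if (i, p i) \<in> B then 1 + w else 1) =
      (\<Sum>S\<in>Pow B. if \<forall>c\<in>S. p (fst c) = snd c then w ^ card S else 0)" for p
  proof -
    let ?G = "{c \<in> B. p (fst c) = snd c}"
    have "(\<Prod>i = 0..<n. if (i, p i) \<in> B then 1 + w else 1) =
        (\<Prod>i\<in>{i \<in> {0..<n}. (i, p i) \<in> B}. 1 + w)"
      by (rule prod.inter_filter[symmetric]) simp
    also have "\<dots> = (\<Prod>c\<in>?G. w + 1)"
      by (rule prod.reindex_bij_witness[where i = fst and j = "\<lambda>i. (i, p i)"]) (use B in \<open>auto simp: add.commute\<close>)
    also have "\<dots> = (\<Sum>S\<in>Pow ?G. w ^ card S)"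
      using finB prod_add[of ?G "\<lambda>_. w" "\<lambda>_. 1"] by simp
    also have "\<dots> = (\<Sum>S\<in>{S \<in> Pow B. \<forall>c\<in>S. p (fst c) = snd c}. w ^ card S)"
      by (rule sum.cong) auto
    also have "\<dots> = (\<Sum>S\<in>Pow B. if \<forall>c\<in>S. p (fst c) = snd c then w ^ card S else 0)"
      by (rule sum.inter_filter) (use finB in simp)
    finally show ?thesis .
  qed
  have ext: "(\<Sum>p\<in>?P. if \<forall>c\<in>S. p (fst c) = snd c then w ^ card S else 0) =
      (if S \<in> rook_placements B then w ^ card S * fact (n - card S) else 0)" if S: "S \<subseteq> B" for S
  proof -
    let ?E = "{p. p permutes {0..<n} \<and> (\<forall>c\<in>S. p (fst c) = snd c)}"
    have "(\<Sum>p\<in>?P. if \<forall>c\<in>S. p (fst c) = snd c then w ^ card S else 0) =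
        (\<Sum>p\<in>{p \<in> ?P. \<forall>c\<in>S. p (fst c) = snd c}. w ^ card S)"
      by (rule sum.inter_filter[symmetric]) (rule finP)
    also have "\<dots> = of_nat (card ?E) * w ^ card S" by simp
    also have "\<dots> = (if S \<in> rook_placements B then w ^ card S * fact (n - card S) else 0)"
    proof (cases "S \<in> rook_placements B")
      case True
      then have "card ?E = fact (n - card S)"
        using card_permutes_extending[of "{0..<n}" S] S B by (auto simp: rook_placements_def)
      then show ?thesis using True by simp
    next
      case False
      have "?E = {}"
      proof (rule ccontr)
        assume "?E \<noteq> {}"
        then obtain p where p: "p permutes {0..<n}" "\<forall>c\<in>S. p (fst c) = snd c" by auto
        have "inj_on fst S" "inj_on snd S"
          using p(2) permutes_inj[OF p(1)]
          by (metis inj_onI prod_eqI, metis inj_onI injD prod_eqI)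
        then show False using False S by (simp add: rook_placements_def)
      qed
      then have "card ?E = 0" by (simp only: card.empty)
      then show ?thesis using False by simp
    qed
    finally show ?thesis .
  qed
  have "permanent (mat n n (\<lambda>c. if c \<in> B then 1 + w else 1)) =
      (\<Sum>p\<in>?P. \<Prod>i = 0..<n. if (i, p i) \<in> B then 1 + w else 1)"
    unfolding permanent_def
    by (auto intro!: sum.cong prod.cong simp: permutes_in_image[THEN iffD2])
  also have "\<dots> = (\<Sum>S\<in>Pow B. \<Sum>p\<in>?P. if \<forall>c\<in>S. p (fst c) = snd c then w ^ card S else 0)"
    by (simp only: row) (rule sum.swap)
  also have "\<dots> = (\<Sum>S\<in>Pow B. if S \<in> rook_placements B then w ^ card S * fact (n - card S) else 0)"
    by (intro sum.cong refl ext) simp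
  also have "\<dots> = (\<Sum>S\<in>{S \<in> Pow B. S \<in> rook_placements B}. w ^ card S * fact (n - card S))"
    by (rule sum.inter_filter[symmetric]) (use finB in simp)
  also have "{S \<in> Pow B. S \<in> rook_placements B} = rook_placements B"
    by (auto simp: rook_placements_def)
  finally show ?thesis .
qed

text \<open>Cells \<open>i \<noteq> j\<close> of the staircase attack each other iff \<open>i\<close> and \<open>j\<close> are consecutive.\<close>

definition staircase_cell :: "nat \<Rightarrow> nat \<times> nat" where
  "staircase_cell i = (Suc i div 2, i div 2)"

section \<open>Boards inside the staircase and their rook polynomials\<close>

definition staircase_board :: "bool list \<Rightarrow> (nat \<times> nat) set" where
  "staircase_board l = staircase_cell ` {i. i < length l \<and> l ! i}"

definition sparse_subsets :: "bool list \<Rightarrow> nat set set" where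
  "sparse_subsets l = {I. I \<subseteq> {i. i < length l \<and> l ! i} \<and> (\<forall>i\<in>I. Suc i \<notin> I)}"

lemma finite_sparse_subsets: "finite (sparse_subsets l)"
  by (rule finite_subset[of _ "Pow {..<length l}"]) (auto simp: sparse_subsets_def)

lemma inj_staircase_cell: "inj staircase_cell"
proof (rule inj_on_inverseI)
  fix i
  have "Suc i div 2 + i div 2 = i" by presburger
  then show "(\<lambda>(a, b). a + b) (staircase_cell i) = i" by (simp add: staircase_cell_def)
qed

text \<open>Consecutive cells share a row or a column, while an index gap of at least 2 changes both
  halved coordinates. Rook placements thus become index sets without two consecutive
  elements.\<close>

lemma staircase_cell_nonattacking_iff:
  "inj_on fst (staircase_cell ` I) \<and> inj_on snd (staircase_cell ` I) \<longleftrightarrow> (\<forall>i\<in>I. Suc i \<notin> I)"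
proof
  assume *: "inj_on fst (staircase_cell ` I) \<and> inj_on snd (staircase_cell ` I)"
  show "\<forall>i\<in>I. Suc i \<notin> I"
  proof safe
    fix i assume i: "i \<in> I" "Suc i \<in> I"
    have "fst (staircase_cell i) = fst (staircase_cell (Suc i)) \<or>
        snd (staircase_cell i) = snd (staircase_cell (Suc i))"
      unfolding staircase_cell_def by (simp, presburger)
    then have "staircase_cell i = staircase_cell (Suc i)"
      using * i by (meson imageI inj_onD)
    then show False using inj_staircase_cell by (meson injD n_not_Suc_n)
  qed
next
  assume *: "\<forall>i\<in>I. Suc i \<notin> I"
  have far: "a div 2 \<noteq> b div 2" if "a + 2 \<le> b" for a b :: nat
    using div_le_mono[OF that, of 2] by simp
  have "i = j" if "i \<in> I" "j \<in> I" "Suc i div 2 = Suc j div 2 \<or> i div 2 = j div 2" for i j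
  proof -
    have "\<not> i + 2 \<le> j" "\<not> j + 2 \<le> i"
      using that(3) far[of i j] far[of "Suc i" "Suc j"] far[of j i] far[of "Suc j" "Suc i"] by auto
    then have "i = j \<or> j = Suc i \<or> i = Suc j" by linarith
    then show ?thesis using * that by auto
  qed
  then show "inj_on fst (staircase_cell ` I) \<and> inj_on snd (staircase_cell ` I)"
    by (auto simp: inj_on_def staircase_cell_def)
qed

lemma rook_placements_staircase:
  "rook_placements (staircase_board l) = (`) staircase_cell ` sparse_subsets l"
proof -
  have "S \<in> rook_placements (staircase_board l) \<longleftrightarrow> S \<in> (`) staircase_cell ` sparse_subsets l" for S
    unfolding rook_placements_def staircase_board_def sparse_subsets_def
    using staircase_cell_nonattacking_iff by (auto simp: subset_image_iff)
  then show ?thesis by blast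
qed

text \<open>Recursion for the rook polynomial at the first cell: it stays empty, or it holds a rook,
  which blocks only the next cell. The convention \<open>tl [] = []\<close> covers the last
  cell.\<close>

fun run_poly :: "bool list \<Rightarrow> real poly" where
  "run_poly [] = 1"
| "run_poly (b # l) = run_poly l + (if b then monom 1 1 * run_poly (tl l) else 0)"

lemma sparse_subsets_Cons:
  "sparse_subsets (b # l) = (`) Suc ` sparse_subsets l \<union>
    (if b then (\<lambda>I. insert 0 ((\<lambda>i. Suc (Suc i)) ` I)) ` sparse_subsets (tl l) else {})"
  (is "_ = ?R")
proof (intro equalityI subsetI)
  fix I assume I: "I \<in> sparse_subsets (b # l)"
  show "I \<in> ?R"
  proof (cases "0 \<in> I")
    case False
    define J where "J = {i. Suc i \<in> I}"
    have "I = Suc ` J"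
      using False unfolding J_def by (auto simp: image_iff) (metis not0_implies_Suc)
    moreover have "J \<in> sparse_subsets l" using I by (auto simp: sparse_subsets_def J_def)
    ultimately show ?thesis by blast
  next
    case True
    define J where "J = {i. Suc (Suc i) \<in> I}"
    have one: "Suc 0 \<notin> I" and b using I True by (auto simp: sparse_subsets_def)
    have "I = insert 0 ((\<lambda>i. Suc (Suc i)) ` J)"
      using True one unfolding J_def by (auto simp: image_iff) (metis not0_implies_Suc)
    moreover have "J \<in> sparse_subsets (tl l)"
      using I by (cases l) (auto simp: sparse_subsets_def J_def)
    ultimately show ?thesis using \<open>b\<close> by auto
  qed
next
  fix I assume "I \<in> ?R"
  then show "I \<in> sparse_subsets (b # l)"
    by (cases l) (auto simp: sparse_subsets_def split: if_splits)
qed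

text \<open>The two families in \<open>sparse_subsets_Cons\<close> are disjoint, since only the
  second has sets containing 0, and there the size grows by one. This identifies
  \<open>run_poly\<close> as the rook polynomial.\<close>

lemma sum_sparse_subsets: "(\<Sum>I\<in>sparse_subsets l. monom 1 (card I)) = run_poly l"
proof (induction l rule: run_poly.induct)
  case 1
  then show ?case by (simp add: sparse_subsets_def cong: conj_cong)
next
  case (2 b l)
  let ?g = "\<lambda>I. insert 0 ((\<lambda>i. Suc (Suc i)) ` I)"
  have inj_Suc: "inj_on ((`) Suc) (sparse_subsets l)"
    by (rule inj_on_image) simp
  have inj_g: "inj_on ?g (sparse_subsets (tl l))"
    by (rule inj_onI) (auto simp: set_eq_iff image_iff)
  have fin: "finite I" if "I \<in> sparse_subsets k" for I k
    using that by (auto simp: sparse_subsets_def intro: finite_subset[of _ "{..<length k}"])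
  have card_g: "card (?g I) = Suc (card I)" if "I \<in> sparse_subsets (tl l)" for I
    using fin[OF that] by (subst card_insert_disjoint) (auto simp: card_image inj_on_def)
  have shift: "(\<Sum>I\<in>(`) Suc ` sparse_subsets l. monom (1 :: real) (card I)) = run_poly l"
    using 2(1) by (simp add: sum.reindex[OF inj_Suc] card_image)
  show ?case
  proof (cases b)
    case False
    then show ?thesis using shift by (simp add: sparse_subsets_Cons)
  next
    case True
    have "(\<Sum>I\<in>?g ` sparse_subsets (tl l). monom (1 :: real) (card I)) =
        monom 1 1 * run_poly (tl l)"
      using 2(2)[OF True, symmetric] card_g
      by (simp add: sum.reindex[OF inj_g] sum_distrib_left mult_monom)
    moreover have "(`) Suc ` sparse_subsets l \<inter> ?g ` sparse_subsets (tl l) = {}" by auto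
    ultimately show ?thesis using True shift finite_sparse_subsets
      by (simp add: sparse_subsets_Cons sum.union_disjoint)
  qed
qed

section \<open>The permanent as a linear functional of the rook polynomial\<close>

definition rook_eval :: "nat \<Rightarrow> real poly \<Rightarrow> real" where
  "rook_eval n P = (\<Sum>j\<le>n. coeff P j * (- 2) ^ j * fact (n - j))"

lemma rook_eval_add: "rook_eval n (P + Q) = rook_eval n P + rook_eval n Q"
  by (simp add: rook_eval_def sum.distrib algebra_simps)

lemma rook_eval_diff: "rook_eval n (P - Q) = rook_eval n P - rook_eval n Q"
  by (simp add: rook_eval_def sum_subtractf algebra_simps)

lemma rook_eval_smult: "rook_eval n (smult c P) = c * rook_eval n P"
  by (simp add: rook_eval_def sum_distrib_left mult.assoc)

lemma rook_eval_sum: "rook_eval n (\<Sum>i\<in>I. f i) = (\<Sum>i\<in>I. rook_eval n (f i))"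
  unfolding rook_eval_def by (subst sum.swap) (simp add: coeff_sum sum_distrib_right)

lemma rook_eval_monom: "k \<le> n \<Longrightarrow> rook_eval n (monom 1 k) = (- 2) ^ k * fact (n - k)"
  by (simp add: rook_eval_def if_distrib[where f = "\<lambda>x. x * _"] cong: if_cong)

text \<open>The entry -1 is written \<open>1 + (- 2)\<close> to match \<open>permanent_board\<close>
  with \<open>w = - 2\<close>.\<close>

definition staircase_mat :: "nat \<Rightarrow> bool list \<Rightarrow> real mat" where
  "staircase_mat n l = mat n n (\<lambda>c. if c \<in> staircase_board l then 1 + (- 2) else 1)"

lemma staircase_mat_in_sign_mats: "staircase_mat n l \<in> sign_mats n"
  by (auto simp: staircase_mat_def sign_mats_def)

lemma permanent_staircase_mat:
  assumes "length l \<le> n"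
  shows "permanent (staircase_mat n l) = rook_eval n (run_poly l)"
proof -
  have sub: "staircase_board l \<subseteq> {0..<n} \<times> {0..<n}"
    using assms by (auto simp: staircase_board_def staircase_cell_def)
  have inj: "inj_on ((`) staircase_cell) (sparse_subsets l)"
    by (rule inj_on_image) (meson inj_staircase_cell inj_on_subset subset_UNIV)
  have card: "card (staircase_cell ` I) = card I" for I
    by (rule card_image) (meson inj_staircase_cell inj_on_subset subset_UNIV)
  have le: "card I \<le> n" if "I \<in> sparse_subsets l" for I
      proof -
    have "I \<subseteq> {..<length l}" using that by (auto simp: sparse_subsets_def)
    then show ?thesis using assms card_mono[of "{..<length l}" I] by simp
  qed
  have "permanent (staircase_mat n l) =
      (\<Sum>I\<in>sparse_subsets l. (- 2) ^ card I * fact (n - card I))"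
    unfolding staircase_mat_def permanent_board[OF sub] rook_placements_staircase
    by (simp add: sum.reindex[OF inj] card)
  also have "\<dots> = (\<Sum>I\<in>sparse_subsets l. rook_eval n (monom 1 (card I)))"
    using le by (simp add: rook_eval_monom)
  also have "\<dots> = rook_eval n (run_poly l)"
    by (simp add: rook_eval_sum[symmetric] sum_sparse_subsets)
  finally show ?thesis .
qed

section \<open>Estimates for the functional\<close>

text \<open>Models the rook polynomial of a board with at most \<open>e\<close> cells:
  \<open>(1 + x) ^ e\<close> counts all sets of \<open>e\<close> cells, attacking or not. The notion
  is closed under products, with the bounds \<open>e\<close> adding up.\<close>

definition tame_poly :: "nat \<Rightarrow> real poly \<Rightarrow> bool" where
  "tame_poly e P \<longleftrightarrow> (\<forall>j. 0 \<le> coeff P j) \<and> coeff P 0 = 1 \<and> degree P \<le> e \<and>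
     (\<forall>x\<ge>0. poly P x \<le> (1 + x) ^ e)"

lemma tame_poly_1: "tame_poly 0 1"
  by (auto simp: tame_poly_def coeff_1)

lemma tame_poly_mult: "tame_poly e P \<Longrightarrow> tame_poly f Q \<Longrightarrow> tame_poly (e + f) (P * Q)"
proof -
  assume P: "tame_poly e P" and Q: "tame_poly f Q"
  have "poly P x * poly Q x \<le> (1 + x) ^ e * (1 + x) ^ f" if "0 \<le> x" for x
  proof (rule mult_mono)
    show "0 \<le> poly Q x"
      using Q that by (simp add: tame_poly_def poly_altdef sum_nonneg)
  qed (use P Q that in \<open>auto simp: tame_poly_def\<close>)
  moreover have "degree (P * Q) \<le> e + f"
    using P Q degree_mult_le[of P Q] by (simp add: tame_poly_def)
  ultimately show ?thesis
    using P Q by (auto simp: tame_poly_def coeff_mult power_add intro!: sum_nonneg)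
qed

lemma tame_poly_power: "tame_poly e P \<Longrightarrow> tame_poly (e * k) (P ^ k)"
  by (induction k) (auto simp: tame_poly_1 intro: tame_poly_mult)

lemma tame_poly_mono: "tame_poly e P \<Longrightarrow> e \<le> f \<Longrightarrow> tame_poly f P"
  unfolding tame_poly_def
  by (auto intro: order_trans power_increasing)
    (meson add_increasing2 order_trans power_increasing le_add_same_cancel1)

text \<open>Each of the \<open>s\<close> factors that separate the two factorials is at least
  \<open>n / 2\<close>.\<close>

lemma fact_descend:
  assumes "2 * (d + s) \<le> n"
  shows "fact (n - (d + s)) * (real n / 2) ^ s \<le> fact (n - d)"
  using assms
proof (induction s)
  case (Suc s)
  have "fact (n - (d + Suc s)) * (real n / 2) ^ Suc s
      = (real n / 2) * fact (n - (d + Suc s)) * (real n / 2) ^ s"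
    by simp
  also have "\<dots> \<le> real (n - (d + s)) * fact (n - (d + Suc s)) * (real n / 2) ^ s"
    using Suc.prems by (intro mult_right_mono) auto
  also have "\<dots> = fact (n - (d + s)) * (real n / 2) ^ s"
  proof -
    have "n - (d + s) = Suc (n - (d + Suc s))" using Suc.prems by simp
    then show ?thesis by simp
  qed
  also have "\<dots> \<le> fact (n - d)" using Suc by simp
  finally show ?case .
qed simp

text \<open>Since \<open>(n-d-s)! \<le> (2/n)^s (n-d)!\<close>, the terms other than the leading one contribute at most
  the factor \<open>Q(4/n) - 1\<close>, which is small.\<close>

lemma rook_eval_tame_poly:
  assumes Q: "tame_poly e Q" and e: "16 * e \<le> n" and d: "2 * (d + e) \<le> n"
  shows "\<bar>rook_eval n (monom 1 d * Q) - (- 2) ^ d * fact (n - d)\<bar> \<le> 2 ^ d * fact (n - d) / 3"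
proof -
  define g where "g s = coeff Q s * ((- 2) ^ (d + s) * fact (n - (d + s)))" for s
  have nonneg: "\<And>s. 0 \<le> coeff Q s" and deg: "degree Q \<le> e" and Q0: "coeff Q 0 = 1"
    using Q by (auto simp: tame_poly_def)
  have Q_sum: "Q = (\<Sum>s\<le>e. monom (coeff Q s) s)"
    using poly_as_sum_of_monoms'[OF deg] by simp
  have "monom 1 d * Q = (\<Sum>s\<le>e. smult (coeff Q s) (monom 1 (d + s)))"
    by (subst Q_sum) (simp add: sum_distrib_left mult_monom smult_monom)
  then have "rook_eval n (monom 1 d * Q) = (\<Sum>s\<le>e. g s)"
    using d by (simp add: rook_eval_sum rook_eval_smult rook_eval_monom g_def)
  also have "\<dots> = g 0 + (\<Sum>s\<in>{1..e}. g s)"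
  proof -
    have "{..e} = insert 0 {1..e}" by auto
    then show ?thesis by simp
  qed
  finally have "\<bar>rook_eval n (monom 1 d * Q) - (- 2) ^ d * fact (n - d)\<bar> = \<bar>\<Sum>s\<in>{1..e}. g s\<bar>"
    by (simp add: g_def Q0)
  also have "\<dots> \<le> (\<Sum>s\<in>{1..e}. \<bar>g s\<bar>)" by (rule sum_abs)
  also have "\<dots> \<le> (\<Sum>s\<in>{1..e}. 2 ^ d * fact (n - d) * (coeff Q s * (4 / n) ^ s))"
  proof (rule sum_mono)
    fix s assume s: "s \<in> {1..e}"
    then have n: "real n > 0" using e by simp
    have "fact (n - (d + s)) * (real n / 2) ^ s \<le> fact (n - d)"
      using s d by (intro fact_descend) simp
    then have "fact (n - (d + s)) \<le> fact (n - d) * (2 / real n) ^ s"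
      using n by (simp add: field_simps power_divide)
    then have "2 ^ s * fact (n - (d + s)) \<le> 2 ^ s * (fact (n - d) * (2 / real n) ^ s)"
      by (rule mult_left_mono) simp
    also have "\<dots> = fact (n - d) * (4 / real n) ^ s"
      by (simp add: power_mult_distrib[symmetric] algebra_simps)
    finally have "coeff Q s * 2 ^ d * (2 ^ s * fact (n - (d + s)))
        \<le> coeff Q s * 2 ^ d * (fact (n - d) * (4 / real n) ^ s)"
      using nonneg by (intro mult_left_mono) auto
    then show "\<bar>g s\<bar> \<le> 2 ^ d * fact (n - d) * (coeff Q s * (4 / n) ^ s)"
      using nonneg[of s] by (simp add: g_def abs_mult power_abs power_add mult_ac)
  qed
  also have "\<dots> = 2 ^ d * fact (n - d) * (poly Q (4 / n) - 1)"
  proof -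
    have "poly Q (4 / n) = (\<Sum>s\<le>e. coeff Q s * (4 / n) ^ s)"
      by (subst Q_sum) (simp add: poly_sum poly_monom)
    also have "\<dots> = 1 + (\<Sum>s\<in>{1..e}. coeff Q s * (4 / n) ^ s)"
    proof -
      have "{..e} = insert 0 {1..e}" by auto
      then show ?thesis by (simp add: Q0)
    qed
    finally show ?thesis by (simp add: sum_distrib_left)
  qed
  also have "\<dots> \<le> 2 ^ d * fact (n - d) * (1 / 3)"
  proof (rule mult_left_mono)
    have "poly Q (4 / n) \<le> (1 + 4 / n) ^ e" using Q by (simp add: tame_poly_def)
    also have "\<dots> \<le> exp (4 / n) ^ e" by (intro power_mono exp_ge_add_one_self) auto
    also have "\<dots> = exp (e * (4 / n))" by (simp only: exp_of_nat_mult)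
    \<comment> \<open>The hypothesis \<open>16 * e \<le> n\<close> keeps the exponent at most 1/4,
      and 1 + 1/4 + 1/16 = 21/16 is below 4/3.\<close>
    also have "\<dots> \<le> exp (1 / 4)" using e by (cases "n = 0") (auto simp: field_simps)
    also have "\<dots> \<le> 1 + 1 / 4 + (1 / 4)\<^sup>2" by (rule exp_bound) auto
    also have "\<dots> \<le> 4 / 3" by (simp add: power2_eq_square)
    finally show "poly Q (4 / n) - 1 \<le> 1 / 3" by simp
  qed simp
  finally show ?thesis by simp
qed

section \<open>Gadgets of prescribed order\<close>

definition path_poly :: "nat \<Rightarrow> real poly" where
  "path_poly m = run_poly (replicate m True)"

lemma path_poly_simps [simp]:
  "path_poly 0 = 1"
  "path_poly (Suc 0) = 1 + monom 1 1"
  "path_poly (Suc (Suc m)) = path_poly (Suc m) + monom 1 1 * path_poly m"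
  by (simp_all add: path_poly_def)

text \<open>The gap prevents attacks between the run and the rest, so placements on both sides
  combine freely. Two-step induction matches the two-term recursion.\<close>

lemma run_poly_replicate_append:
  "run_poly (replicate m True @ False # l) = path_poly m * run_poly l"
  by (induction m rule: induct_nat_012) (simp_all add: algebra_simps)

text \<open>By the recursion, raising \<open>m\<close> by one multiplies the left-hand side by
  \<open>- x\<close>; it starts from \<open>(1 + x)^2 - (1 + 2 x) = x^2\<close>.\<close>

lemma path_poly_cassini:
  "path_poly (Suc m) ^ 2 - path_poly m * path_poly (Suc (Suc m)) = smult ((- 1) ^ m) (monom 1 (m + 2))"
proof (induction m)
  case 0
  show ?case by (simp add: power2_eq_square algebra_simps mult_monom)
next
  case (Suc m)
  have "path_poly (Suc (Suc m)) ^ 2 - path_poly (Suc m) * path_poly (Suc (Suc (Suc m))) =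
      - (monom 1 1 * (path_poly (Suc m) ^ 2 - path_poly m * path_poly (Suc (Suc m))))"
    by (simp add: power2_eq_square algebra_simps)
  then show ?case by (simp only: Suc) (simp add: mult_monom smult_monom minus_monom)
qed

lemma tame_path_poly: "tame_poly m (path_poly m)"
proof (induction m rule: induct_nat_012)
  case 0
  then show ?case by (simp add: tame_poly_1)
next
  case 1
  have "degree (1 + monom 1 1 :: real poly) \<le> 1"
    by (intro degree_add_le) (auto simp: degree_monom_eq)
  then show ?case
    by (auto simp: tame_poly_def poly_monom coeff_1)
next
  case (ge2 m)
  let ?P = "path_poly (Suc m)" and ?Q = "path_poly m"
  have "degree (monom 1 1 * ?Q) \<le> Suc (Suc m)"
    using degree_mult_le[of "monom 1 1" ?Q] ge2(1) by (simp add: tame_poly_def degree_monom_eq)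
  then have "degree (?P + monom 1 1 * ?Q) \<le> Suc (Suc m)"
    using ge2(2) by (intro degree_add_le) (auto simp: tame_poly_def)
  moreover have "poly ?P x + x * poly ?Q x \<le> (1 + x) ^ Suc (Suc m)" if "0 \<le> x" for x
  proof -
    have "poly ?P x + x * poly ?Q x \<le> (1 + x) ^ Suc m + x * (1 + x) ^ m"
      using ge2 that by (intro add_mono mult_left_mono) (auto simp: tame_poly_def)
    also have "\<dots> \<le> (1 + x) ^ Suc m + x * (1 + x) ^ Suc m"
      using that by (intro add_mono mult_left_mono power_increasing) auto
    also have "\<dots> = (1 + x) ^ Suc (Suc m)" by (simp add: algebra_simps)
    finally show ?thesis .
  qed
  ultimately show ?case
    using ge2 by (auto simp: tame_poly_def coeff_monom_mult poly_monom)
qed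

text \<open>This and \<open>skew_gadget\<close> are the rook polynomials of two ways to split
  \<open>2 * m + 2\<close> cells into two runs. By Cassini they differ only in the coefficient of
  degree \<open>m + 2\<close>.\<close>

definition even_gadget :: "nat \<Rightarrow> real poly" where
  "even_gadget m = path_poly (Suc m) ^ 2"

definition skew_gadget :: "nat \<Rightarrow> real poly" where
  "skew_gadget m = path_poly m * path_poly (Suc (Suc m))"

lemma tame_gadgets: "tame_poly (2 * m + 2) (even_gadget m)" "tame_poly (2 * m + 2) (skew_gadget m)"
  using tame_poly_power[OF tame_path_poly[of "Suc m"], of 2]
    tame_poly_mult[OF tame_path_poly[of m] tame_path_poly[of "Suc (Suc m)"]]
  by (simp_all add: even_gadget_def skew_gadget_def mult.commute[of m] mult_2
      del: path_poly_simps)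

text \<open>A digit in base \<open>T + 1\<close>: of \<open>T\<close> gadgets, \<open>t\<close> are
  even. Keeping the total at \<open>T\<close> makes the board size independent of the digit.\<close>

definition digit_poly :: "nat \<Rightarrow> nat \<Rightarrow> nat \<Rightarrow> real poly" where
  "digit_poly T m t = even_gadget m ^ t * skew_gadget m ^ (T - t)"

lemma tame_gadget_powers:
  "tame_poly ((2 * m + 2) * (a + b)) (even_gadget m ^ a * skew_gadget m ^ b)"
  using tame_poly_mult[OF tame_poly_power[OF tame_gadgets(1)] tame_poly_power[OF tame_gadgets(2)]]
  by (simp add: distrib_left)

lemma tame_digit_poly: "t \<le> T \<Longrightarrow> tame_poly ((2 * m + 2) * T) (digit_poly T m t)"
  using tame_gadget_powers[of m t "T - t"] by (simp add: digit_poly_def)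

text \<open>Telescoping: skew gadgets become even one at a time, and each exchange contributes the
  Cassini monomial times the other \<open>T - 1\<close> gadgets. All contributions carry the same
  sign, so they cannot cancel.\<close>

lemma digit_poly_diff:
  assumes "u \<le> t" "t \<le> T"
  shows "digit_poly T m t - digit_poly T m u = smult ((- 1) ^ m)
    (\<Sum>s = u..<t. monom 1 (m + 2) * (even_gadget m ^ s * skew_gadget m ^ (T - Suc s)))"
  using assms
proof (induction t rule: dec_induct)
  case (step t)
  let ?A = "even_gadget m" and ?B = "skew_gadget m"
  have "T - t = Suc (T - Suc t)" using step by simp
  then have "digit_poly T m (Suc t) - digit_poly T m t = (?A - ?B) * (?A ^ t * ?B ^ (T - Suc t))"
    by (simp add: digit_poly_def algebra_simps)
  also have "?A - ?B = smult ((- 1) ^ m) (monom 1 (m + 2))"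
    using path_poly_cassini by (simp add: even_gadget_def skew_gadget_def)
  finally have "digit_poly T m (Suc t) =
      digit_poly T m t + smult ((- 1) ^ m) (monom 1 (m + 2) * (?A ^ t * ?B ^ (T - Suc t)))"
    by (simp add: algebra_simps)
  then show ?case using step by (simp add: smult_add_right algebra_simps)
qed simp

text \<open>\<open>C\<close> stands for the gadgets of all other levels. Each of the
  \<open>t - u\<close> telescoped terms is a monomial times a tame polynomial, so its value is
  within \<open>M / 3\<close> of the common leading value, whose modulus is
  \<open>M\<close>.\<close>

lemma rook_eval_digit_change_ordered:
  assumes C: "tame_poly e C" and N: "e + (2 * m + 2) * T \<le> N" "16 * N \<le> n" "2 * (m + 2 + N) \<le> n"
    and "u \<le> t" "t \<le> T"
  defines "M \<equiv> 2 ^ (m + 2) * fact (n - (m + 2))"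
  defines "v \<equiv> \<bar>rook_eval n (C * (digit_poly T m t - digit_poly T m u))\<bar>"
  shows "v \<le> 4 / 3 * (real t - real u) * M" "v \<ge> 2 / 3 * (real t - real u) * M"
proof -
  define F where "F s = rook_eval n (monom 1 (m + 2) *
      (C * (even_gadget m ^ s * skew_gadget m ^ (T - Suc s))))" for s
  have "C * (digit_poly T m t - digit_poly T m u) = smult ((- 1) ^ m) (\<Sum>s = u..<t. monom 1 (m + 2) *
      (C * (even_gadget m ^ s * skew_gadget m ^ (T - Suc s))))"
    unfolding digit_poly_diff[OF \<open>u \<le> t\<close> \<open>t \<le> T\<close>]
    by (simp add: sum_distrib_left mult_ac)
  then have v: "v = \<bar>\<Sum>s = u..<t. F s\<bar>"
    by (simp add: v_def F_def rook_eval_smult rook_eval_sum abs_mult)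
  have F: "\<bar>F s - (- 2) ^ (m + 2) * fact (n - (m + 2))\<bar> \<le> M / 3" if s: "s \<in> {u..<t}" for s
    unfolding F_def M_def
  proof (rule rook_eval_tame_poly)
    have "(2 * m + 2) * (s + (T - Suc s)) \<le> (2 * m + 2) * T"
      using s \<open>t \<le> T\<close> by (intro mult_left_mono) auto
    then show "tame_poly N (C * (even_gadget m ^ s * skew_gadget m ^ (T - Suc s)))"
      using N by (intro tame_poly_mono[OF tame_poly_mult[OF C tame_gadget_powers]]) auto
  qed (use N in auto)
  have "\<bar>(\<Sum>s = u..<t. F s) - (real t - real u) * ((- 2) ^ (m + 2) * fact (n - (m + 2)))\<bar> =
      \<bar>\<Sum>s = u..<t. F s - (- 2) ^ (m + 2) * fact (n - (m + 2))\<bar>"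
    using \<open>u \<le> t\<close> by (simp add: sum_subtractf of_nat_diff)
  also have "\<dots> \<le> (\<Sum>s = u..<t. M / 3)"
    by (rule order_trans[OF sum_abs]) (intro sum_mono F)
  also have "\<dots> = (real t - real u) * M / 3" using \<open>u \<le> t\<close> by (simp add: of_nat_diff)
  finally have "\<bar>(\<Sum>s = u..<t. F s) - (real t - real u) * ((- 2) ^ (m + 2) * fact (n - (m + 2)))\<bar>
      \<le> (real t - real u) * M / 3" .
  moreover have "\<bar>(real t - real u) * ((- 2) ^ (m + 2) * fact (n - (m + 2)))\<bar> = (real t - real u) * M"
    using \<open>u \<le> t\<close> by (simp add: M_def abs_mult power_abs)
  ultimately show "v \<le> 4 / 3 * (real t - real u) * M" "v \<ge> 2 / 3 * (real t - real u) * M"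
    unfolding v by linarith+
qed

lemma rook_eval_digit_change:
  assumes C: "tame_poly e C" and N: "e + (2 * m + 2) * T \<le> N" "16 * N \<le> n" "2 * (m + 2 + N) \<le> n"
    and "u \<le> T" "t \<le> T"
  defines "M \<equiv> 2 ^ (m + 2) * fact (n - (m + 2))"
  defines "v \<equiv> \<bar>rook_eval n (C * (digit_poly T m t - digit_poly T m u))\<bar>"
  shows "v \<le> 4 / 3 * \<bar>real t - real u\<bar> * M" "v \<ge> 2 / 3 * \<bar>real t - real u\<bar> * M"
proof -
  have "v = \<bar>rook_eval n (C * (digit_poly T m u - digit_poly T m t))\<bar>"
    unfolding v_def by (simp add: right_diff_distrib rook_eval_diff)
  then show "v \<le> 4 / 3 * \<bar>real t - real u\<bar> * M" "v \<ge> 2 / 3 * \<bar>real t - real u\<bar> * M"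
    using rook_eval_digit_change_ordered[OF C N, of u t] rook_eval_digit_change_ordered[OF C N, of t u]
      \<open>u \<le> T\<close> \<open>t \<le> T\<close>
    by (cases "u \<le> t"; simp add: v_def M_def)+
qed

section \<open>Digit strings over all levels, most significant digit first\<close>

fun level_poly :: "nat \<Rightarrow> nat \<Rightarrow> nat list \<Rightarrow> real poly" where
  "level_poly T m [] = 1"
| "level_poly T m (t # ts) = digit_poly T m t * level_poly T (Suc m) ts"

text \<open>Closed form of \<open>T\<close> times the sum of \<open>2 * i + 4\<close> over the
  \<open>k\<close> levels \<open>i\<close> from \<open>m\<close> on: each gadget has
  \<open>2 * i + 2\<close> cells and two gaps.\<close>

definition level_size :: "nat \<Rightarrow> nat \<Rightarrow> nat \<Rightarrow> nat" where
  "level_size T m k = T * (k * (2 * m + k + 3))"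

lemma level_size_Suc: "level_size T m (Suc k) = (2 * m + 4) * T + level_size T (Suc m) k"
  by (simp add: level_size_def algebra_simps)

lemma tame_level_poly: "set ts \<subseteq> {..T} \<Longrightarrow> tame_poly (level_size T m (length ts)) (level_poly T m ts)"
proof (induction ts arbitrary: m)
  case Nil
  then show ?case by (simp add: level_size_def tame_poly_1)
next
  case (Cons t ts)
  have "tame_poly ((2 * m + 2) * T + level_size T (Suc m) (length ts)) (level_poly T m (t # ts))"
    using tame_poly_mult[OF tame_digit_poly] Cons by simp
  then show ?case by (rule tame_poly_mono) (simp add: level_size_Suc add_mult_distrib)
qed

text \<open>One level further, the scale \<open>2 ^ (m + 2) * fact (n - (m + 2))\<close> is
  multiplied by \<open>2 / (n - (m + 2))\<close>, and the denominator is at least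
  \<open>160 * T\<close>. Hence \<open>2 * T\<close> units of the next scale make at most 4/160 of
  the present one.\<close>

lemma fact_level_step:
  assumes "320 * T \<le> n" "2 * (m + 3) \<le> n"
  shows "2 * real T * (2 ^ (Suc m + 2) * fact (n - (Suc m + 2))) \<le> 2 ^ (m + 2) * fact (n - (m + 2)) / 40"
proof -
  have "n - (m + 2) = Suc (n - (Suc m + 2))" using assms by simp
  then have eq: "(fact (n - (m + 2)) :: real) = real (n - (m + 2)) * fact (n - (Suc m + 2))" by simp
  have "160 * T + (m + 2) \<le> n" using assms by simp
  then have "160 * T \<le> n - (m + 2)" by simp
  then have "160 * real T \<le> real (n - (m + 2))" by (metis of_nat_le_iff of_nat_mult of_nat_numeral)
  then have "160 * real T * fact (n - (Suc m + 2)) \<le> fact (n - (m + 2))"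
    unfolding eq by (intro mult_right_mono) auto
  then have "2 ^ m * (160 * real T * fact (n - (Suc m + 2))) \<le> 2 ^ m * fact (n - (m + 2))"
    by (intro mult_left_mono) auto
  then show ?thesis by simp
qed

text \<open>Change the head digit while keeping the tail \<open>ts\<close>, then change the tail
  while keeping the head \<open>u\<close>.\<close>

lemma level_poly_split:
  "C * (level_poly T m (t # ts) - level_poly T m (u # us)) =
    C * level_poly T (Suc m) ts * (digit_poly T m t - digit_poly T m u) +
    C * digit_poly T m u * (level_poly T (Suc m) ts - level_poly T (Suc m) us)"
  by (simp add: algebra_simps)

text \<open>A single level already takes \<open>(2 * m + 4) * T\<close> cells, so \<open>N\<close>
  is at least both \<open>2 * m + 4\<close> and \<open>4 * T\<close>; the factor 80 then yields
  every bound, in particular 320 = 80 * 4.\<close>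

lemma level_bounds:
  assumes "0 < T" "80 * N \<le> n" "e + level_size T m (Suc k) \<le> N"
  shows "16 * N \<le> n" "2 * (m + 2 + N) \<le> n" "320 * T \<le> n" "2 * (m + 3) \<le> n"
proof -
  have "(2 * m + 4) * 1 \<le> (2 * m + 4) * T" using assms(1) by (intro mult_le_mono2) simp
  moreover have "4 * T \<le> (2 * m + 4) * T" by simp
  moreover have "(2 * m + 4) * T \<le> N" using assms(3) by (simp only: level_size_Suc)
  ultimately have "2 * m + 4 \<le> N" "4 * T \<le> N" by (metis mult_1_right order_trans)+
  then show "16 * N \<le> n" "2 * (m + 2 + N) \<le> n" "320 * T \<le> n" "2 * (m + 3) \<le> n"
    using assms(2) by simp_all
qed

text \<open>In units of the scale at \<open>m\<close>, the head digit contributes at most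
  \<open>4 / 3 * T\<close> and the tail, by induction, at most 1/40. \<open>C\<close> is arbitrary
  because the induction absorbs the head digit into it.\<close>

lemma rook_eval_level_poly_diff_le:
  assumes "0 < T" "80 * N \<le> n"
  shows "length ts = length us \<Longrightarrow> set ts \<subseteq> {..T} \<Longrightarrow> set us \<subseteq> {..T} \<Longrightarrow> tame_poly e C \<Longrightarrow>
    e + level_size T m (length ts) \<le> N \<Longrightarrow>
    \<bar>rook_eval n (C * (level_poly T m ts - level_poly T m us))\<bar>
      \<le> 2 * real T * (2 ^ (m + 2) * fact (n - (m + 2)))"
proof (induction ts us arbitrary: m e C rule: list_induct2')
  case 1
  then show ?case by (simp add: rook_eval_def)
next
  case (4 t ts u us)
  let ?M = "2 ^ (m + 2) * fact (n - (m + 2)) :: real"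
  have size: "e + (2 * m + 2) * T + level_size T (Suc m) (length ts) \<le> N"
    using 4(6) by (simp add: level_size_Suc add_mult_distrib)
  note bounds = level_bounds[OF assms, of e m "length ts"]
  have digits: "t \<le> T" "u \<le> T" using 4 by auto
  have "tame_poly (e + level_size T (Suc m) (length ts)) (C * level_poly T (Suc m) ts)"
    using 4 by (intro tame_poly_mult tame_level_poly) auto
  from rook_eval_digit_change(1)[OF this _ _ _ digits(2,1), of m N n]
  have "\<bar>rook_eval n (C * level_poly T (Suc m) ts * (digit_poly T m t - digit_poly T m u))\<bar>
      \<le> 4 / 3 * \<bar>real t - real u\<bar> * ?M"
    using size bounds 4(6) by (simp add: add_ac)
  also have "\<dots> \<le> 4 / 3 * real T * ?M"
    using digits by (intro mult_right_mono mult_left_mono) auto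
  finally have first: "\<bar>rook_eval n (C * level_poly T (Suc m) ts * (digit_poly T m t - digit_poly T m u))\<bar>
      \<le> 4 / 3 * real T * ?M" .
  have "tame_poly (e + (2 * m + 2) * T) (C * digit_poly T m u)"
    using 4 digits by (intro tame_poly_mult tame_digit_poly) auto
  from 4(1)[OF _ _ _ this, of "Suc m"]
  have "\<bar>rook_eval n (C * digit_poly T m u * (level_poly T (Suc m) ts - level_poly T (Suc m) us))\<bar>
      \<le> 2 * real T * (2 ^ (Suc m + 2) * fact (n - (Suc m + 2)))"
    using size 4 by simp
  also have "\<dots> \<le> ?M / 40" using bounds 4(6) by (intro fact_level_step) auto
  also have "\<dots> \<le> real T * ?M / 40"
    using assms(1) by (intro divide_right_mono mult_right_mono[of 1 "real T" ?M, simplified]) auto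
  finally have "\<bar>rook_eval n (C * (level_poly T m (t # ts) - level_poly T m (u # us)))\<bar>
      \<le> 4 / 3 * real T * ?M + real T * ?M / 40"
    using first unfolding level_poly_split rook_eval_add by linarith
  also have "\<dots> \<le> 2 * real T * ?M" by simp
  finally show ?case .
qed auto

text \<open>Equal leading digits are absorbed into \<open>C\<close>. At the first difference the
  digits are at least 1 apart, so that level contributes at least 2/3 of its scale, while all later
  levels together contribute at most 1/40.\<close>

lemma rook_eval_level_poly_neq:
  assumes "0 < T" "80 * N \<le> n"
  shows "length ts = length us \<Longrightarrow> set ts \<subseteq> {..T} \<Longrightarrow> set us \<subseteq> {..T} \<Longrightarrow> tame_poly e C \<Longrightarrow>
    e + level_size T m (length ts) \<le> N \<Longrightarrow> ts \<noteq> us \<Longrightarrow>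
    rook_eval n (C * (level_poly T m ts - level_poly T m us)) \<noteq> 0"
proof (induction ts us arbitrary: m e C rule: list_induct2')
  case (4 t ts u us)
  let ?M = "2 ^ (m + 2) * fact (n - (m + 2)) :: real"
  have size: "e + (2 * m + 2) * T + level_size T (Suc m) (length ts) \<le> N"
    using 4(6) by (simp add: level_size_Suc add_mult_distrib)
  note bounds = level_bounds[OF assms, of e m "length ts"]
  have digits: "t \<le> T" "u \<le> T" using 4 by auto
  have C': "tame_poly (e + (2 * m + 2) * T) (C * digit_poly T m u)"
    using 4 digits by (intro tame_poly_mult tame_digit_poly) auto
  show ?case
  proof (cases "t = u")
    case True
    then show ?thesis
      using 4(1)[OF _ _ _ C', of "Suc m"] size 4 by (simp add: level_poly_split del: level_poly.simps)
  next
    case False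
    have "?M > 0" by simp
    have "tame_poly (e + level_size T (Suc m) (length ts)) (C * level_poly T (Suc m) ts)"
      using 4 by (intro tame_poly_mult tame_level_poly) auto
    from rook_eval_digit_change(2)[OF this _ _ _ digits(2,1), of m N n]
    have "2 / 3 * \<bar>real t - real u\<bar> * ?M
        \<le> \<bar>rook_eval n (C * level_poly T (Suc m) ts * (digit_poly T m t - digit_poly T m u))\<bar>"
      using size bounds 4(6) by (simp add: add_ac)
    moreover have "2 / 3 * 1 * ?M \<le> 2 / 3 * \<bar>real t - real u\<bar> * ?M"
      using False by (intro mult_right_mono mult_left_mono) auto
    moreover have "\<bar>rook_eval n (C * digit_poly T m u * (level_poly T (Suc m) ts - level_poly T (Suc m) us))\<bar>
        \<le> 2 * real T * (2 ^ (Suc m + 2) * fact (n - (Suc m + 2)))"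
      using size 4 by (intro rook_eval_level_poly_diff_le[OF assms _ _ _ C']) auto
    moreover have "2 * real T * (2 ^ (Suc m + 2) * fact (n - (Suc m + 2))) \<le> ?M / 40"
      using bounds 4(6) by (intro fact_level_step) auto
    ultimately show ?thesis
      using \<open>?M > 0\<close> unfolding level_poly_split rook_eval_add by linarith
  qed
qed auto

section \<open>Counting permanents\<close>

text \<open>The closing gap lets gadgets be concatenated without attacking each other.\<close>

definition gadget_board :: "nat \<Rightarrow> nat \<Rightarrow> bool list" where
  "gadget_board a b = replicate a True @ False # replicate b True @ [False]"

fun level_board :: "nat \<Rightarrow> nat \<Rightarrow> nat list \<Rightarrow> bool list" where
  "level_board T m [] = []"
| "level_board T m (t # ts) =
    concat (replicate t (gadget_board (Suc m) (Suc m))) @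
    concat (replicate (T - t) (gadget_board m (Suc (Suc m)))) @ level_board T (Suc m) ts"

lemma run_poly_gadgets:
  "run_poly (concat (replicate k (gadget_board a b)) @ l) = (path_poly a * path_poly b) ^ k * run_poly l"
  by (induction k) (simp_all add: gadget_board_def run_poly_replicate_append mult_ac)

lemma run_poly_level_board: "run_poly (level_board T m ts) = level_poly T m ts"
  by (induction ts arbitrary: m)
    (simp_all add: run_poly_gadgets digit_poly_def even_gadget_def skew_gadget_def power2_eq_square mult_ac)

text \<open>Even and skew gadgets both take \<open>2 * m + 4\<close> positions, gaps included, so
  the digits do not affect the length.\<close>

lemma length_level_board:
  "set ts \<subseteq> {..T} \<Longrightarrow> length (level_board T m ts) = level_size T m (length ts)"
proof (induction ts arbitrary: m)
  case Nil
  then show ?case by (simp add: level_size_def)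
next
  case (Cons t ts)
  then have "t \<le> T" by simp
  then have "t * (2 * m + 4) + (T - t) * (2 * m + 4) = (2 * m + 4) * T"
    by (metis add_mult_distrib le_add_diff_inverse mult.commute)
  moreover have "length (gadget_board (Suc m) (Suc m)) = 2 * m + 4"
    "length (gadget_board m (Suc (Suc m))) = 2 * m + 4"
    by (simp_all add: gadget_board_def)
  moreover have "length (concat (replicate k l)) = k * length l" for k and l :: "bool list"
    by (simp add: length_concat sum_list_replicate)
  moreover have "length (level_board T (Suc m) ts) = level_size T (Suc m) (length ts)"
    using Cons by simp
  ultimately show ?case
    by (simp only: level_board.simps length_append length_Cons level_size_Suc add.assoc[symmetric])
qed

text \<open>Distinct digit strings give distinct permanents, by
  \<open>rook_eval_level_poly_neq\<close> with context \<open>C = 1\<close> and \<open>N\<close>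
  equal to the common board length.\<close>

lemma num_permanents_ge:
  assumes T: "0 < T" and n: "80 * (T * (K * (K + 3))) \<le> n"
  shows "(T + 1) ^ K \<le> num_permanents n"
proof -
  let ?D = "{ts. set ts \<subseteq> {..T} \<and> length ts = K}"
  let ?f = "\<lambda>ts. permanent (staircase_mat n (level_board T 0 ts))"
  have size: "level_size T 0 K = T * (K * (K + 3))" by (simp add: level_size_def)
  have val: "?f ts = rook_eval n (level_poly T 0 ts)" if "ts \<in> ?D" for ts
    using that n by (subst permanent_staircase_mat)
      (auto simp: run_poly_level_board length_level_board size)
  have "inj_on ?f ?D"
  proof (rule inj_onI, rule ccontr)
    fix ts us assume *: "ts \<in> ?D" "us \<in> ?D" "?f ts = ?f us" "ts \<noteq> us"
    then have "rook_eval n (1 * (level_poly T 0 ts - level_poly T 0 us)) \<noteq> 0"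
      using size by (intro rook_eval_level_poly_neq[OF T n _ _ _ tame_poly_1]) auto
    then show False using * val by (simp add: rook_eval_diff)
  qed
  then have "card (?f ` ?D) = card ?D" by (rule card_image)
  also have "\<dots> = (T + 1) ^ K" by (simp add: card_lists_length_eq)
  finally have "(T + 1) ^ K = card (?f ` ?D)" by simp
  also have "\<dots> \<le> num_permanents n"
    unfolding num_permanents_def
    by (intro card_mono finite_imageI finite_sign_mats) (auto intro: staircase_mat_in_sign_mats)
  finally show ?thesis .
qed

section \<open>Choice of parameters and asymptotics\<close>

lemma num_permanents_ge_powr_ln:
  "\<forall>\<^sub>F n::nat in sequentially. real n powr (ln (real n) / 4) \<le> real (num_permanents n)"
proof -
  have "\<forall>\<^sub>F n::nat in sequentially. 80 * (sqrt (real n) * (ln (real n) * (ln (real n) + 3))) \<le> real n"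
    by real_asymp
  moreover have "\<forall>\<^sub>F n::nat in sequentially. 2 \<le> ln (real n)" by real_asymp
  moreover have "\<forall>\<^sub>F n::nat in sequentially. 1 \<le> n" by (rule eventually_ge_at_top)
  ultimately show ?thesis
  proof eventually_elim
    case (elim n)
    \<comment> \<open>With these choices the board length is of order
      \<open>sqrt n * (ln n)^2\<close>, which is o(n), while \<open>(T + 1) ^ K\<close> is at least
      \<open>n powr (K / 2)\<close>.\<close>
    define T where "T = nat \<lfloor>sqrt (real n)\<rfloor>"
    define K where "K = nat \<lfloor>ln (real n)\<rfloor>"
    have T: "real T \<le> sqrt (real n)" "sqrt (real n) \<le> real (T + 1)" "0 < T"
      using elim(3) unfolding T_def by (auto intro: less_imp_le) linarith+
    have K: "real K \<le> ln (real n)" "ln (real n) - 1 \<le> real K"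
      using elim(2) unfolding K_def by linarith+
    have "real (80 * (T * (K * (K + 3)))) \<le> 80 * (sqrt (real n) * (ln (real n) * (ln (real n) + 3)))"
      unfolding of_nat_mult of_nat_add using T K elim(2)
      by (intro mult_mono add_mono mult_nonneg_nonneg add_nonneg_nonneg) auto
    then have "80 * (T * (K * (K + 3))) \<le> n" using elim(1) by linarith
    then have "(T + 1) ^ K \<le> num_permanents n" using T(3) by (rule num_permanents_ge[rotated])
    then have "real (T + 1) ^ K \<le> real (num_permanents n)"
      by (metis of_nat_le_iff of_nat_power)
    moreover have "sqrt (real n) ^ K \<le> real (T + 1) ^ K"
      using T by (intro power_mono) auto
    moreover have "sqrt (real n) ^ K = real n powr (real K / 2)"
      using elim(3) by (simp add: powr_half_sqrt[symmetric] powr_realpow[symmetric] powr_powr)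
    \<comment> \<open>From \<open>ln n \<ge> 2\<close> follows
      \<open>K \<ge> ln n - 1 \<ge> ln n / 2\<close>.\<close>
    moreover have "real n powr (ln (real n) / 4) \<le> real n powr (real K / 2)"
      using elim K by (intro powr_mono) auto
    ultimately show ?case by linarith
  qed
qed

theorem theorem2:
  shows "\<exists>c::real. c > 0 \<and> (\<forall>\<^sub>F n::nat in sequentially.
    real (num_permanents n) \<ge> real n powr (c * (ln (real n) / ln (ln (real n)))))"
proof (intro exI[of _ "1 / 4"] conjI)
  \<comment> \<open>Once \<open>ln (ln n)\<close> is at least 1, dividing by it only lowers the
    exponent, so the constant 1/4 carries over from the stronger bound.\<close>
  have "\<forall>\<^sub>F n::nat in sequentially. 1 \<le> ln (ln (real n))" by real_asymp
  moreover have "\<forall>\<^sub>F n::nat in sequentially. 1 \<le> n" by (rule eventually_ge_at_top)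
  ultimately show "\<forall>\<^sub>F n::nat in sequentially.
      real (num_permanents n) \<ge> real n powr (1 / 4 * (ln (real n) / ln (ln (real n))))"
    using num_permanents_ge_powr_ln
  proof eventually_elim
    case (elim n)
    have "ln (real n) / ln (ln (real n)) \<le> ln (real n) / 1"
      using elim by (intro divide_left_mono) auto
    then have "real n powr (1 / 4 * (ln (real n) / ln (ln (real n)))) \<le> real n powr (ln (real n) / 4)"
      using elim(2) by (intro powr_mono) auto
    then show ?case using elim(3) by linarith
  qed
qed simp

end
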